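(* For all $a,b\in\mathbb Z$ we have $M_1(a)\,M_1(b)=M_1(a+b)$, where the product is the usual matrix product of $\mathbb N_0\times\mathbb N_0$ matrices over $\mathbb Z$.
   Context: For $n\in\mathbb N_0$ with binary representation $n=n_0+n_12+n_22^2+\cdots$ ($n_i\in\{0,1\}$), let $s_2(n)=n_0+n_1+n_2+\cdots$ be the binary sum of digits. For $a\in\mathbb Z\setminus\{0\}$ define the $\mathbb N_0\times\mathbb N_0$ integer matrix $M_1(a)=\big(\big(\binom{j}{i}\bmod 2\big)\,a^{s_2(j)-s_2(i)}\big)_{i,j\ge 0}$, where $\binom{j}{i}=0$ for $i>j$ and $\binom{j}{i}\bmod 2\in\{0,1\}$ is regarded as an integer (whenever $\binom{j}{i}\bmod 2=1$ one has $s_2(j)\ge s_2(i)$, so the entries are integers). Set $M_1(0)=(\delta_{i,j})_{i,j\ge0}$, the identity matrix. These matrices are upper triangular, so products involve only finite sums. *)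

theory Defs
  imports Complex_Main "HOL-Library.Groups_Big_Fun"
begin

definition s2 :: "nat \<Rightarrow> nat" where
  "s2 n = Sum_any (\<lambda>i. n div 2 ^ i mod 2)"

text \<open>
  The subtraction in the exponent is truncated, but never actually truncates where it matters:
  see \<open>s2_le_if_odd_binomial\<close> and \<open>M1_eq_powi\<close> below.
\<close>

definition M1 :: "int \<Rightarrow> nat \<Rightarrow> nat \<Rightarrow> int" where
  "M1 a i j =
    (if a = 0 then (if i = j then 1 else 0)
     else int ((j choose i) mod 2) * a ^ (s2 j - s2 i))"

text \<open>
  \<open>Sum_any\<close> is the sum over the support, and 0 if the support is infinite. The latter case does
  not arise for the matrices \<open>M1 a\<close>: see \<open>finite_support_M1_mult\<close>.
\<close>

definition mat_mult :: "(nat \<Rightarrow> nat \<Rightarrow> int) \<Rightarrow> (nat \<Rightarrow> nat \<Rightarrow> int) \<Rightarrow> nat \<Rightarrow> nat \<Rightarrow> int"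
    (infixl "\<cdot>\<^sub>M" 70) where
  "(A \<cdot>\<^sub>M B) i j = Sum_any (\<lambda>k. A i k * B k j)"

lemma support_digits: "{i. n div 2 ^ i mod 2 \<noteq> (0::nat)} \<subseteq> {..<n}"
proof
  fix i assume "i \<in> {i. n div 2 ^ i mod 2 \<noteq> 0}"
  then have "n div 2 ^ i \<noteq> 0" by (intro notI) simp
  then have "2 ^ i \<le> n" by (simp add: div_eq_0_iff)
  moreover have "i < (2::nat) ^ i" by (rule less_exp)
  ultimately show "i \<in> {..<n}" unfolding lessThan_iff by (rule less_le_trans[rotated])
qed

lemma s2_rec: "s2 n = n mod 2 + s2 (n div 2)"
proof -
  have "s2 m = (\<Sum>i<N. m div 2 ^ i mod 2)" if "m \<le> N" for m N :: nat
    unfolding s2_def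
  proof (rule Sum_any.expand_superset)
    show "{i. m div 2 ^ i mod 2 \<noteq> 0} \<subseteq> {..<N}"
      using support_digits[of m] that by fastforce
  qed simp
  note * = this
  have "s2 n = (\<Sum>i<Suc n. n div 2 ^ i mod 2)" by (rule *) simp
  also have "\<dots> = n mod 2 + (\<Sum>i<n. n div 2 ^ Suc i mod 2)"
    by (simp only: sum.lessThan_Suc_shift) simp
  also have "(\<Sum>i<n. n div 2 ^ Suc i mod 2) = s2 (n div 2)"
    by (subst *[of "n div 2" n]) (simp_all add: div_mult2_eq)
  finally show ?thesis .
qed

lemma even_binomial_double: "even ((2 * n) choose (2 * k + 1))"
  and odd_binomial_double: "odd ((2 * n) choose (2 * k)) \<longleftrightarrow> odd (n choose k)"
proof -
  have "\<forall>k. even ((2 * n) choose (2 * k + 1)) \<and>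
    (odd ((2 * n) choose (2 * k)) \<longleftrightarrow> odd (n choose k))"
  proof (induction n)
    case 0
    have "even ((2 * 0) choose (2 * k + 1)) \<and>
      (odd ((2 * 0) choose (2 * k)) \<longleftrightarrow> odd (0 choose k))" for k :: nat
      by (cases k) simp_all
    then show ?case by blast
  next
    case (Suc n)
    show ?case
    proof
      fix k
      show "even ((2 * Suc n) choose (2 * k + 1)) \<and>
        (odd ((2 * Suc n) choose (2 * k)) \<longleftrightarrow> odd (Suc n choose k))"
      proof (cases k)
        case 0
        then show ?thesis by simp
      next
        case (Suc l)
        have "even ((2 * n) choose (2 * l + 1))" "even ((2 * n) choose (2 * Suc l + 1))"
          "odd ((2 * n) choose (2 * l)) \<longleftrightarrow> odd (n choose l)"
          "odd ((2 * n) choose (2 * Suc l)) \<longleftrightarrow> odd (n choose Suc l)"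
          using Suc.IH by blast+
        then show ?thesis by (simp add: Suc)
      qed
    qed
  qed
  then show "even ((2 * n) choose (2 * k + 1))"
    and "odd ((2 * n) choose (2 * k)) \<longleftrightarrow> odd (n choose k)" by blast+
qed

lemma odd_binomial_halves:
  assumes "odd (j choose i)"
  shows "i mod 2 \<le> j mod 2" "odd ((j div 2) choose (i div 2))"
proof -
  obtain n where n: "j = 2 * n \<or> j = 2 * n + 1" by (rule that[of "j div 2"]) presburger
  obtain k where k: "i = 2 * k \<or> i = 2 * k + 1" by (rule that[of "i div 2"]) presburger
  have d: "odd ((2 * n) choose (2 * k)) \<longleftrightarrow> odd (n choose k)"
    by (rule odd_binomial_double)
  have e': "even ((2 * n) choose Suc (2 * k))" using even_binomial_double[of n k] by simp
  have "i mod 2 \<le> j mod 2 \<and> odd ((j div 2) choose (i div 2))"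
    using n k
  proof (elim disjE)
    assume "j = 2 * n + 1" "i = 2 * k"
    moreover have "even ((2 * n) choose (2 * k - 1))" if "k > 0"
      using that even_binomial_double[of n "k - 1"] by (auto simp: gr0_conv_Suc)
    ultimately show ?thesis using assms d by (cases k) auto
  qed (use assms e' d in auto)
  then show "i mod 2 \<le> j mod 2" "odd ((j div 2) choose (i div 2))" by blast+
qed

lemma s2_le_if_odd_binomial: "odd (j choose i) \<Longrightarrow> s2 i \<le> s2 j"
proof (induction j arbitrary: i rule: less_induct)
  case (less j)
  show ?case
  proof (cases "j = 0")
    case True
    then have "i = 0" using less.prems by (cases i) auto
    then show ?thesis using True by simp
  next
    case False
    then have "s2 (i div 2) \<le> s2 (j div 2)"
      using less odd_binomial_halves(2) by simp
    then show ?thesis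
      using odd_binomial_halves(1)[OF less.prems] s2_rec[of i] s2_rec[of j] by linarith
  qed
qed

lemma M1_eq_powi:
  assumes "a \<noteq> 0"
  shows "(of_int (M1 a i j) :: rat) =
    of_nat ((j choose i) mod 2) * of_int a powi (int (s2 j) - int (s2 i))"
proof (cases "odd (j choose i)")
  case True
  then have "int (s2 j) - int (s2 i) = int (s2 j - s2 i)"
    by (intro of_nat_diff[symmetric] s2_le_if_odd_binomial)
  then show ?thesis using assms by (simp only: M1_def power_int_of_nat) simp
next
  case False
  then show ?thesis using assms by (simp add: M1_def)
qed

lemma M1_upper_triangular: "j < i \<Longrightarrow> M1 a i j = 0"
  by (simp add: M1_def binomial_eq_0)

lemma finite_support_M1_mult: "finite {k. M1 a i k * M1 b k j \<noteq> 0}"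
proof (rule finite_subset)
  show "{k. M1 a i k * M1 b k j \<noteq> 0} \<subseteq> {..j}"
  proof
    fix k assume "k \<in> {k. M1 a i k * M1 b k j \<noteq> 0}"
    then have "M1 b k j \<noteq> 0" by simp
    then show "k \<in> {..j}" using M1_upper_triangular[of j k b] by (meson atMost_iff not_le)
  qed
qed simp

end

theory Submission
  imports Defs
begin

text \<open>
  Splitting indices by their last binary digit exhibits \<open>M1 a\<close> as a self-similar matrix: it is the
  Kronecker product of \<open>M1 a\<close> with the block \<open>((1, a), (0, 1))\<close>. These blocks satisfy the claim,
  and so the truncations of \<open>M1 a\<close> to size \<open>2 ^ m\<close> satisfy it by induction on \<open>m\<close>.
\<close>

lemma s2_double [simp]: "s2 (2 * n) = s2 n"
  and s2_Suc_double [simp]: "s2 (Suc (2 * n)) = Suc (s2 n)"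
  by (subst s2_rec; simp)+

lemma even_binomial_double_Suc: "even ((2 * n) choose Suc (2 * k))"
  using even_binomial_double[of n k] by simp

lemma odd_binomial_Suc_double_Suc_double:
  "odd (Suc (2 * n) choose Suc (2 * k)) \<longleftrightarrow> odd (n choose k)"
  using even_binomial_double_Suc[of n k] odd_binomial_double[of n k] by simp

lemma odd_binomial_Suc_double_double: "odd (Suc (2 * n) choose (2 * k)) \<longleftrightarrow> odd (n choose k)"
proof (cases k)
  case (Suc l)
  then show ?thesis
    using even_binomial_double_Suc[of n l] odd_binomial_double[of n k] by simp
qed simp

text \<open>The last-digit step of Lucas's theorem modulo 2; the rows with odd top follow from the
  even ones by Pascal's rule.\<close>

lemmas odd_binomial_digit =
  odd_binomial_double even_binomial_double_Suc
  odd_binomial_Suc_double_double odd_binomial_Suc_double_Suc_double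

lemma M1_eq_if_odd:
  "a \<noteq> 0 \<Longrightarrow> M1 a i j = (if odd (j choose i) then a ^ (s2 j - s2 i) else 0)"
  by (auto simp: M1_def odd_iff_mod_2_eq_one)

lemma M1_double_double: "M1 a (2 * i) (2 * j) = M1 a i j"
  by (cases "a = 0") (simp_all add: M1_def[of 0] M1_eq_if_odd odd_binomial_digit)

lemma M1_Suc_double_Suc_double: "M1 a (Suc (2 * i)) (Suc (2 * j)) = M1 a i j"
  \<comment> \<open>Pascal's rule as a rewrite would break up the coefficient before the parity
    rules can match it.\<close>
  by (cases "a = 0")
    (simp_all add: M1_def[of 0] M1_eq_if_odd odd_binomial_digit del: binomial_Suc_Suc)

lemma M1_Suc_double_double: "M1 a (Suc (2 * i)) (2 * j) = 0"
proof (cases "a = 0")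
  case True
  have "Suc (2 * i) \<noteq> 2 * j" by presburger
  then show ?thesis using True by (simp add: M1_def)
qed (simp add: M1_eq_if_odd odd_binomial_digit)

lemma M1_double_Suc_double: "M1 a (2 * i) (Suc (2 * j)) = a * M1 a i j"
proof (cases "a = 0")
  case True
  have "2 * i \<noteq> Suc (2 * j)" by presburger
  then show ?thesis using True by (simp add: M1_def)
next
  case False
  then show ?thesis
    \<comment> \<open>The extra factor \<open>a\<close> comes from the additional digit 1 of the
      column index; \<open>s2 i \<le> s2 j\<close> keeps the truncated subtraction exact.\<close>
    by (auto simp: M1_eq_if_odd odd_binomial_digit Suc_diff_le dest: s2_le_if_odd_binomial)
qed

lemmas M1_digit =
  M1_double_double M1_double_Suc_double M1_Suc_double_double M1_Suc_double_Suc_double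

lemma M1_0_right: "M1 a i 0 = (if i = 0 then 1 else 0)"
  by (cases i) (simp_all add: M1_def)

lemma sum_lessThan_double:
  "(\<Sum>k<2 * n. f k) = (\<Sum>k<n. f (2 * k) + f (Suc (2 * k)))" for f :: "nat \<Rightarrow> 'a::comm_monoid_add"
  by (induction n) (simp_all add: ac_simps)

text \<open>Each induction step strips the last binary digit of \<open>i\<close>, \<open>j\<close>
  and \<open>k\<close>.\<close>

lemma M1_mult_truncated:
  "j < 2 ^ m \<Longrightarrow> (\<Sum>k<2 ^ m. M1 a i k * M1 b k j) = M1 (a + b) i j"
proof (induction m arbitrary: i j)
  case 0
  then show ?case by (simp add: M1_0_right)
next
  case (Suc m)
  define i' j' where "i' = i div 2" and "j' = j div 2"
  have i: "i = 2 * i' \<or> i = Suc (2 * i')" and j: "j = 2 * j' \<or> j = Suc (2 * j')"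
    unfolding i'_def j'_def by presburger+
  have IH: "(\<Sum>k<2 ^ m. M1 a i' k * M1 b k j') = M1 (a + b) i' j'"
    using Suc j by (intro Suc.IH) auto
  \<comment> \<open>For even \<open>i\<close> and odd \<open>j\<close>, odd \<open>k\<close>
    contribute the first sum and even \<open>k\<close> the second, giving the factor
    \<open>a + b\<close>.\<close>
  have "(\<Sum>k<2 ^ m. a * M1 a i' k * M1 b k j') = a * M1 (a + b) i' j'"
    and "(\<Sum>k<2 ^ m. M1 a i' k * (b * M1 b k j')) = b * M1 (a + b) i' j'"
    by (simp_all flip: IH add: sum_distrib_left mult_ac)
  then show ?case
    using i j IH
    by (auto simp: sum_lessThan_double M1_digit sum.distrib distrib_right)
qed

theorem theorem1:
  fixes a b :: int
  shows "M1 a \<cdot>\<^sub>M M1 b = M1 (a + b)"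
proof (intro ext)
  fix i j :: nat
  \<comment> \<open>Since \<open>j < 2 ^ j\<close>, the truncation with \<open>m = j\<close>
    contains every nonzero term.\<close>
  have "{k. M1 a i k * M1 b k j \<noteq> 0} \<subseteq> {..<2 ^ j}"
  proof
    fix k assume "k \<in> {k. M1 a i k * M1 b k j \<noteq> 0}"
    then have "k \<le> j" using M1_upper_triangular[of j k b] by (auto simp: not_less[symmetric])
    also have "j < 2 ^ j" by (rule less_exp)
    finally show "k \<in> {..<2 ^ j}" by simp
  qed
  then have "(M1 a \<cdot>\<^sub>M M1 b) i j = (\<Sum>k<2 ^ j. M1 a i k * M1 b k j)"
    unfolding mat_mult_def by (intro Sum_any.expand_superset) simp_all
  also have "\<dots> = M1 (a + b) i j"
    by (intro M1_mult_truncated less_exp)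
  finally show "(M1 a \<cdot>\<^sub>M M1 b) i j = M1 (a + b) i j" .
qed

end
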